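(* $\mathrm{DO}(M)$ is a closed subset of $\mathrm{TO}(M)$ and hence compact.
   Context: $K$ is a field, $t\ge1$ an integer, $K[X]=K[X_1,\dots,X_t]$ the commutative polynomial ring, $M=\{X^\nu\mid\nu\in\mathbb{N}_0^t\}$ its set of monomials. $\mathrm{TO}(M)$ is the set of all total orderings on $M$ (antisymmetric, transitive, total binary relations), with the coarsest topology for which all sets $\mathfrak{U}_{(a,b)}=\{{\leq}\in\mathrm{TO}(M)\mid a\leq b\}$, $a,b\in M$, are open; subsets carry the relative topology. For ${\leq}\in\mathrm{TO}(M)$ and $p\in K[X]\setminus\{0\}$, $\mathrm{LM}_\leq(p)$ is the $\leq$-maximal monomial occurring in $p$ with nonzero coefficient. $\mathrm{DO}(M)$ is the set of degree orderings: those ${\leq}\in\mathrm{TO}(M)$ with $\deg(\mathrm{LM}_\leq(p))=\deg(p)$ for all $p\in K[X]\setminus\{0\}$, where $\deg$ is the total degree. *)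

theory Defs
  imports "HOL-Analysis.Analysis" "HOL-Library.Poly_Mapping"
begin

text \<open>
  The ring \<open>K[X\<^sub>1, \<dots>, X\<^sub>t]\<close> is the type of finitely supported functions from exponent
  vectors to coefficients, with the convolution product of \<^theory>\<open>HOL-Library.Poly_Mapping\<close>.
  The variables are indexed by a finite type \<open>'t\<close>, so \<open>t = CARD('t) \<ge> 1\<close>.
\<close>

type_synonym ('t, 'k) mpoly = "('t \<Rightarrow>\<^sub>0 nat) \<Rightarrow>\<^sub>0 'k"

definition monomial :: "('t \<Rightarrow>\<^sub>0 nat) \<Rightarrow> ('t::finite, 'k::field) mpoly"
  where "monomial \<nu> = Poly_Mapping.single \<nu> 1"

definition Monomials :: "('t::finite, 'k::field) mpoly set"
  where "Monomials = range monomial"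

definition occurring :: "('t::finite, 'k::field) mpoly \<Rightarrow> ('t, 'k) mpoly set"
  where "occurring p = monomial ` Poly_Mapping.keys p"

text \<open>Only meaningful for \<open>p \<noteq> 0\<close>, since \<open>Max {}\<close> is unspecified.\<close>

definition total_degree :: "('t::finite, 'k::field) mpoly \<Rightarrow> nat"
  where "total_degree p = (MAX \<nu>\<in>Poly_Mapping.keys p. \<Sum>i\<in>UNIV. Poly_Mapping.lookup \<nu> i)"

text \<open>
  An ordering \<open>\<le>\<close> is the set of pairs \<open>(a, b)\<close> with \<open>a \<le> b\<close>. Totality is meant as
  ``\<open>a \<le> b\<close> or \<open>b \<le> a\<close> for all \<open>a\<close>, \<open>b\<close>'', which includes reflexivity;
  \<^const>\<open>total_on\<close> alone does not, but \<^const>\<open>linear_order_on\<close> does.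
\<close>

definition TO :: "'a set \<Rightarrow> 'a rel set"
  where "TO M = {r. linear_order_on M r}"

definition TO_subbasic :: "'a set \<Rightarrow> 'a \<Rightarrow> 'a \<Rightarrow> 'a rel set"
  where "TO_subbasic M a b = {r \<in> TO M. (a, b) \<in> r}"

definition TO_topology :: "'a set \<Rightarrow> 'a rel topology"
  where "TO_topology M = topology_generated_by {TO_subbasic M a b | a b. a \<in> M \<and> b \<in> M}"

lemma topspace_TO_topology:
  assumes "M \<noteq> {}"
  shows "topspace (TO_topology M) = TO M"
proof -
  obtain a where "a \<in> M" using assms by blast
  then have "TO_subbasic M a a = TO M"
    by (auto simp: TO_subbasic_def TO_def order_on_defs refl_on_def)
  with \<open>a \<in> M\<close> show ?thesis
    unfolding TO_topology_def topology_generated_by_topspace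
    by (auto simp: TO_subbasic_def)
qed

text \<open>The \<open>r\<close>-maximal monomial of \<open>p\<close>; only meaningful for \<open>r \<in> TO Monomials\<close> and \<open>p \<noteq> 0\<close>.\<close>

definition LM :: "('t::finite, 'k::field) mpoly rel \<Rightarrow> ('t, 'k) mpoly \<Rightarrow> ('t, 'k) mpoly"
  where "LM r p = (THE m. m \<in> occurring p \<and> (\<forall>n\<in>occurring p. (n, m) \<in> r))"

lemma linear_order_finite_has_max:
  assumes "linear_order_on M r" "finite S" "S \<noteq> {}" "S \<subseteq> M"
  shows "\<exists>!m. m \<in> S \<and> (\<forall>n\<in>S. (n, m) \<in> r)"
proof -
  have r: "refl_on M r" "trans r" "antisym r" "total_on M r"
    using assms(1) by (auto simp: order_on_defs)
  have "\<exists>m. m \<in> S \<and> (\<forall>n\<in>S. (n, m) \<in> r)"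
    using assms(2-4)
  proof (induction S rule: finite_ne_induct)
    case (singleton x)
    then show ?case using r(1) by (auto simp: refl_on_def)
  next
    case (insert x F)
    then obtain m where m: "m \<in> F" "\<forall>n\<in>F. (n, m) \<in> r" by auto
    have xM: "x \<in> M" "m \<in> M" using insert.prems m(1) by auto
    then consider "(x, m) \<in> r" | "(m, x) \<in> r"
      using r(1,4) by (metis refl_on_def total_on_def)
    then show ?case
    proof cases
      case 1
      then show ?thesis using m by blast
    next
      case 2
      then have "\<forall>n\<in>F. (n, x) \<in> r" using m(2) r(2) by (meson transD)
      then show ?thesis using xM r(1) by (auto simp: refl_on_def)
    qed
  qed
  then show ?thesis using r(3) by (meson antisymD)
qed

lemma LM_unique_maximum:
  assumes "r \<in> TO Monomials" "p \<noteq> 0"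
  shows "LM r p \<in> occurring p \<and> (\<forall>n\<in>occurring p. (n, LM r p) \<in> r)"
proof -
  have "\<exists>!m. m \<in> occurring p \<and> (\<forall>n\<in>occurring p. (n, m) \<in> r)"
    by (rule linear_order_finite_has_max[of Monomials])
      (use assms in \<open>auto simp: TO_def occurring_def Monomials_def\<close>)
  then show ?thesis unfolding LM_def by (rule theI')
qed

definition DO :: "('t::finite, 'k::field) mpoly rel set"
  where "DO = {r \<in> TO Monomials. \<forall>p. p \<noteq> 0 \<longrightarrow> total_degree (LM r p) = total_degree p}"

end

theory Submission
  imports Defs
begin

text \<open>
  Identifying a relation with its characteristic function, the linear orders on \<open>M\<close> form a
  closed subset of the Cantor cube \<open>2\<^bsup>M\<times>M\<^esup>\<close>, so \<open>TO M\<close> is compact by Tychonoff.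
  For fixed \<open>p \<noteq> 0\<close>, the leading monomial of \<open>p\<close> is a locally constant function of the ordering,
  because it is determined by finitely many comparisons; so each condition
  \<open>deg (LM p) = deg p\<close> defines a closed set.
\<close>

abbreviation cube :: "('i \<Rightarrow> bool) topology"
  where "cube \<equiv> product_topology (\<lambda>_. discrete_topology UNIV) UNIV"

lemma compact_space_cube: "compact_space cube"
  by (simp add: compact_space_product_topology compact_space_discrete_topology)

lemma continuous_map_cube_coordinate: "continuous_map cube (discrete_topology UNIV) (\<lambda>f. f i)"
  by (rule continuous_map_product_projection) simp

lemma openin_cube_coordinate: "openin cube {f. f i}"
  using openin_continuous_map_preimage[OF continuous_map_cube_coordinate[of i], of "{True}"]
  by simp

text \<open>Both points of the discrete factor are closed, so a coordinate may appear with either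
  sign in a closed condition.\<close>

lemma closedin_cube_coordinate: "closedin cube {f. f i}" "closedin cube {f. \<not> f i}"
  using closedin_continuous_map_preimage[OF continuous_map_cube_coordinate[of i], of "{True}"]
    closedin_continuous_map_preimage[OF continuous_map_cube_coordinate[of i], of "{False}"]
  by simp_all

text \<open>With the next three lemmas, this lets closedness be read off the syntax of a formula
  built from coordinates and their negations.\<close>

lemma closedin_Collect_all:
  assumes "\<And>x. closedin X {f. P x f}"
  shows "closedin X {f. \<forall>x. P x f}"
proof -
  have "closedin X (\<Inter>x\<in>UNIV. {f. P x f})"
    using assms by (intro closedin_INT) auto
  then show ?thesis by (simp add: Collect_all_eq)
qed

lemma closedin_Collect_disj:
  assumes "closedin X {f. P f}" "closedin X {f. Q f}"
  shows "closedin X {f. P f \<or> Q f}"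
  using closedin_Un[OF assms] by (simp add: Collect_disj_eq)

lemma closedin_Collect_conj:
  assumes "closedin X {f. P f}" "closedin X {f. Q f}"
  shows "closedin X {f. P f \<and> Q f}"
  using closedin_Int[OF assms] by (simp add: Collect_conj_eq)

text \<open>Handles the subformulas that do not mention the relation, such as
  \<open>a \<in> M\<close> or \<open>a = b\<close>.\<close>

lemma closedin_cube_const: "closedin cube {f. P}"
  using closedin_topspace[of cube] by (cases P) simp_all

text \<open>Implications are spelled out as disjunctions so that the closure lemmas above match each
  axiom directly.\<close>

lemma mem_TO_iff:
  "r \<in> TO M \<longleftrightarrow>
    (\<forall>a b. (a, b) \<notin> r \<or> a \<in> M \<and> b \<in> M) \<and>
    (\<forall>a b. a \<notin> M \<or> b \<notin> M \<or> (a, b) \<in> r \<or> (b, a) \<in> r) \<and>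
    (\<forall>a b. (a, b) \<notin> r \<or> (b, a) \<notin> r \<or> a = b) \<and>
    (\<forall>a b c. (a, b) \<notin> r \<or> (b, c) \<notin> r \<or> (a, c) \<in> r)"
proof -
  have "r \<subseteq> M \<times> M \<longleftrightarrow> (\<forall>a b. (a, b) \<notin> r \<or> a \<in> M \<and> b \<in> M)" by auto
  \<comment> \<open>The case \<open>a = b\<close> on the right is reflexivity.\<close>
  moreover have "refl_on M r \<and> total_on M r \<longleftrightarrow>
      (\<forall>a b. a \<notin> M \<or> b \<notin> M \<or> (a, b) \<in> r \<or> (b, a) \<in> r)"
    unfolding refl_on_def total_on_def by metis
  moreover have "antisym r \<longleftrightarrow> (\<forall>a b. (a, b) \<notin> r \<or> (b, a) \<notin> r \<or> a = b)"
    unfolding antisym_def by blast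
  moreover have "trans r \<longleftrightarrow> (\<forall>a b c. (a, b) \<notin> r \<or> (b, c) \<notin> r \<or> (a, c) \<in> r)"
    unfolding trans_def by blast
  ultimately show ?thesis
    unfolding TO_def mem_Collect_eq order_on_defs by argo
qed

lemma closedin_cube_TO: "closedin cube {f. Collect f \<in> TO M}"
  unfolding mem_TO_iff mem_Collect_eq
  by (intro closedin_Collect_all closedin_Collect_conj closedin_Collect_disj
      closedin_cube_const closedin_cube_coordinate)

text \<open>\<open>Collect\<close> turns characteristic functions into relations and maps a closed,
  hence compact, part of the cube continuously onto \<open>TO M\<close>.\<close>

lemma compactin_TO_topology:
  assumes "M \<noteq> {}"
  shows "compactin (TO_topology M) (TO M)"
proof -
  let ?C = "{f. Collect f \<in> TO M}"
  have "continuous_map (subtopology cube ?C) (TO_topology M) Collect"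
    unfolding TO_topology_def
  proof (rule continuous_on_generated_topo)
    fix U assume "U \<in> {TO_subbasic M a b |a b. a \<in> M \<and> b \<in> M}"
    then obtain a b where "U = TO_subbasic M a b" by blast
    then have "Collect -` U \<inter> topspace (subtopology cube ?C) = {f. f (a, b)} \<inter> ?C"
      by (auto simp: TO_subbasic_def)
    then show "openin (subtopology cube ?C) (Collect -` U \<inter> topspace (subtopology cube ?C))"
      using openin_cube_coordinate unfolding openin_subtopology by metis
  next
    \<comment> \<open>A generated topology lives on the union of its generators; for nonempty
      \<open>M\<close> these cover \<open>TO M\<close>.\<close>
    show "Collect ` topspace (subtopology cube ?C) \<subseteq> \<Union>{TO_subbasic M a b |a b. a \<in> M \<and> b \<in> M}"
      using topspace_TO_topology[OF assms]
      unfolding TO_topology_def topology_generated_by_topspace by auto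
  qed
  moreover have "compactin (subtopology cube ?C) ?C"
    using closedin_compact_space[OF compact_space_cube closedin_cube_TO]
    by (simp add: compactin_subtopology)
  ultimately have "compactin (TO_topology M) (Collect ` ?C)"
    by (rule image_compactin[rotated])
  moreover have "Collect ` ?C = TO M"
  proof
    show "TO M \<subseteq> Collect ` ?C"
    proof
      fix r assume "r \<in> TO M"
      then show "r \<in> Collect ` ?C" by (intro image_eqI[of _ _ "\<lambda>x. x \<in> r"]) auto
    qed
  qed blast
  ultimately show ?thesis by simp
qed

lemma Monomials_nonempty: "Monomials \<noteq> {}"
  by (simp add: Monomials_def)

lemma openin_LM_eq:
  fixes p :: "('t::finite, 'k::field) mpoly"
  assumes "p \<noteq> 0"
  shows "openin (TO_topology Monomials) {r \<in> TO Monomials. LM r p = m}"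
proof (cases "m \<in> occurring p")
  case True
  have sub: "occurring p \<subseteq> Monomials" by (auto simp: occurring_def Monomials_def)
  have "LM r p = m \<longleftrightarrow> (\<forall>n\<in>occurring p. (n, m) \<in> r)" if "r \<in> TO Monomials" for r
  proof
    show "LM r p = m \<Longrightarrow> \<forall>n\<in>occurring p. (n, m) \<in> r"
      using LM_unique_maximum[OF that assms] by blast
    assume "\<forall>n\<in>occurring p. (n, m) \<in> r"
    \<comment> \<open>Both \<open>m\<close> and \<open>LM r p\<close> occur in \<open>p\<close>, and
      each bounds all occurring monomials, so antisymmetry identifies them.\<close>
    then have "(LM r p, m) \<in> r" "(m, LM r p) \<in> r"
      using LM_unique_maximum[OF that assms] True by blast+
    then show "LM r p = m"
      using that by (auto simp: TO_def order_on_defs dest: antisymD)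
  qed
  then have "{r \<in> TO Monomials. LM r p = m} = (\<Inter>n\<in>occurring p. TO_subbasic Monomials n m)"
    using True by (auto simp: TO_subbasic_def)
  moreover have "openin (TO_topology Monomials) (\<Inter>n\<in>occurring p. TO_subbasic Monomials n m)"
  proof (rule openin_INT2)
    show "finite (occurring p)" by (simp add: occurring_def)
    \<comment> \<open>An empty intersection would be the whole type of relations instead of a subset
      of \<open>TO Monomials\<close>.\<close>
    show "occurring p \<noteq> {}" using True by blast
    show "openin (TO_topology Monomials) (TO_subbasic Monomials n m)" if "n \<in> occurring p" for n
      unfolding TO_topology_def using that True sub by (intro topology_generated_by_Basis) blast
  qed
  ultimately show ?thesis by simp
next
  case False
  then have "{r \<in> TO Monomials. LM r p = m} = {}"
    using LM_unique_maximum[OF _ assms] by blast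
  then show ?thesis by (metis openin_empty)
qed

lemma closedin_DO:
  "closedin (TO_topology Monomials) (DO :: ('t::finite, 'k::field) mpoly rel set)"
proof -
  let ?V = "\<lambda>p m. {r \<in> TO Monomials. LM r p = (m :: ('t, 'k) mpoly)}"
  \<comment> \<open>An ordering outside \<open>DO\<close> violates the degree condition at some
    \<open>p\<close>; the index \<open>m\<close> is its leading monomial there.\<close>
  have "TO Monomials - (DO :: ('t, 'k) mpoly rel set) =
      (\<Union>{?V p m | p m. p \<noteq> 0 \<and> total_degree m \<noteq> total_degree p})"
    by (auto simp: DO_def)
  moreover have "openin (TO_topology Monomials)
      (\<Union>{?V p m | p m. p \<noteq> 0 \<and> total_degree m \<noteq> total_degree p})"
    by (rule openin_Union) (auto intro: openin_LM_eq)
  moreover have "DO \<subseteq> (TO Monomials :: ('t, 'k) mpoly rel set)"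
    by (auto simp: DO_def)
  ultimately show ?thesis
    by (simp add: closedin_def topspace_TO_topology[OF Monomials_nonempty])
qed

theorem lemma3p10:
  shows "closedin (TO_topology Monomials) (DO :: ('t::finite, 'k::field) mpoly rel set)
       \<and> compactin (TO_topology Monomials) (DO :: ('t, 'k) mpoly rel set)"
  using closedin_DO closed_compactin[OF compactin_TO_topology[OF Monomials_nonempty] _ closedin_DO]
  by (auto simp: DO_def)

end
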